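(* For every $k\ge1$, $\beta_k\le\gamma_k\le\alpha_k\le1$.
   Context: For a measurable $S\subset\mathbb R$ with non-empty interior and $x>0$, let $\tau(S,x)=\min\{|T|:T\subset\mathbb R,\ T+S\supseteq[0,x]\}$; the limit $\tau(S,\mathbb R)=\lim_{x\to\infty}\tau(S,x)/x$ exists, and $e(S,\mathbb R)=1/(\tau(S,\mathbb R)\lambda(S))$ where $\lambda$ is Lebesgue measure. For finite non-empty $S\subset\mathbb Z$, $\tau(S,n)=\min\{|T|:T\subseteq\mathbb Z,\ T+S\supseteq\{1,\dots,n\}\}$, $\tau(S,\mathbb Z)=\lim_{n\to\infty}\tau(S,n)/n$ and $e(S,\mathbb Z)=1/(\tau(S,\mathbb Z)|S|)$. Define $\alpha_k=\inf\{e(S,\mathbb Z):S\subset\mathbb Z,\ |S|=k\}$, $\beta_k=\inf\{e(\bigcup_{i=1}^kI_i,\mathbb R)\}$ over all choices of $k$ bounded intervals $I_1,\dots,I_k\subset\mathbb R$ of positive length, and $\gamma_k$ the same infimum restricted to intervals all of the same length. *)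

theory Defs
  imports "HOL-Analysis.Analysis"
begin

text \<open>In all sums of sets, \<open>T + S\<close> is the Minkowski sum from \<open>Set_Algebras\<close>. The minimum of
  \<open>|T|\<close> is taken over the finite \<open>T\<close>, since \<open>card\<close> is \<open>0\<close> on infinite sets; some finite \<open>T\<close>
  exists whenever \<open>S\<close> has non-empty interior (respectively, is non-empty).\<close>

definition tau_real :: "real set \<Rightarrow> real \<Rightarrow> nat" where
  "tau_real S x = (LEAST n. \<exists>T. finite T \<and> card T = n \<and> {0..x} \<subseteq> T + S)"

definition tau_R :: "real set \<Rightarrow> real" where
  "tau_R S = Lim at_top (\<lambda>x. real (tau_real S x) / x)"

definition e_R :: "real set \<Rightarrow> real" where
  "e_R S = 1 / (tau_R S * measure lebesgue S)"

definition tau_int :: "int set \<Rightarrow> nat \<Rightarrow> nat" where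
  "tau_int S n = (LEAST m. \<exists>T. finite T \<and> card T = m \<and> {1..int n} \<subseteq> T + S)"

definition tau_Z :: "int set \<Rightarrow> real" where
  "tau_Z S = lim (\<lambda>n. real (tau_int S n) / real n)"

definition e_Z :: "int set \<Rightarrow> real" where
  "e_Z S = 1 / (tau_Z S * real (card S))"

definition alpha :: "nat \<Rightarrow> real" where
  "alpha k = Inf {e_Z S | S. finite S \<and> card S = k}"

text \<open>Intervals may be open, closed or half-open, and may overlap.\<close>

definition bounded_pos_interval :: "real set \<Rightarrow> bool" where
  "bounded_pos_interval I \<longleftrightarrow> is_interval I \<and> bounded I \<and> measure lebesgue I > 0"

definition beta :: "nat \<Rightarrow> real" where
  "beta k = Inf {e_R (\<Union>i\<in>{1..k}. I i) | I. \<forall>i\<in>{1..k}. bounded_pos_interval (I i)}"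

definition gamma :: "nat \<Rightarrow> real" where
  "gamma k = Inf {e_R (\<Union>i\<in>{1..k}. I i) | I.
     (\<forall>i\<in>{1..k}. bounded_pos_interval (I i)) \<and>
     (\<forall>i\<in>{1..k}. \<forall>j\<in>{1..k}. measure lebesgue (I i) = measure lebesgue (I j))}"

end

theory Submission
  imports Defs
begin

text \<open>Covering numbers are monotone and subadditive, so a Fekete argument gives the limits
  defining \<open>tau_R\<close> and \<open>tau_Z\<close>, and all efficiencies are nonnegative. For a finite set \<open>S\<close> of
  integers, \<open>S + [0,1)\<close> is a union of \<open>|S|\<close> unit intervals. Rounding up the translations of a
  real cover by \<open>S + [0,1)\<close> gives an integer cover by \<open>S\<close>, so passing from \<open>S\<close> to \<open>S + [0,1)\<close>
  does not increase the efficiency. Finally, counting shows that \<open>n\<close> integers need at least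
  \<open>n / |S|\<close> translates of \<open>S\<close>.\<close>

section \<open>Fekete's lemma for a real argument\<close>

text \<open>Subadditivity controls \<open>f\<close> along the multiples of a fixed \<open>a\<close>,
  and monotonicity carries that bound to the points between them. Every ratio \<open>f a / a\<close>
  thus bounds \<open>f x / x\<close> from above up to a vanishing error.\<close>

lemma mono_subadditive_tendsto:
  fixes f :: "real \<Rightarrow> real"
  assumes mono: "\<And>x y. 0 \<le> x \<Longrightarrow> x \<le> y \<Longrightarrow> f x \<le> f y"
    and subadd: "\<And>x y. 0 \<le> x \<Longrightarrow> 0 \<le> y \<Longrightarrow> f (x + y) \<le> f x + f y"
    and nonneg: "\<And>x. 0 \<le> x \<Longrightarrow> 0 \<le> f x"
  shows "((\<lambda>x. f x / x) \<longlongrightarrow> (INF a\<in>{0<..}. f a / a)) at_top"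
proof -
  define L where "L = (INF a\<in>{0<..}. f a / a)"
  have bdd: "bdd_below ((\<lambda>a. f a / a) ` {0<..})"
    by (rule bdd_belowI[of _ 0]) (auto simp: nonneg)
  have L_le: "L \<le> f x / x" if "x > 0" for x
    unfolding L_def by (rule cINF_lower[OF bdd]) (use that in simp)
  have mult: "f (real (Suc m) * a) \<le> real (Suc m) * f a" if "a > 0" for a m
  proof (induction m)
    case (Suc m)
    have "f (real (Suc m) * a + a) \<le> f (real (Suc m) * a) + f a"
      using that by (intro subadd) auto
    with Suc show ?case by (simp add: algebra_simps)
  qed simp
  \<comment> \<open>Here \<open>x\<close> is rounded up to the multiple \<open>Suc m * a\<close>.
    For fixed \<open>a\<close> the price of rounding, \<open>f a / x\<close>, tends to 0.\<close>
  have upper: "f x / x \<le> f a / a + f a / x" if "a > 0" "x > 0" for a x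
  proof -
    define m where "m = nat \<lfloor>x / a\<rfloor>"
    have m: "real m \<le> x / a" "x / a \<le> real (Suc m)"
      using that by (auto simp: m_def) linarith+
    have "f x \<le> f (real (Suc m) * a)"
      using m that by (intro mono) (auto simp: field_simps)
    also have "\<dots> \<le> real (Suc m) * f a" using that by (intro mult)
    also have "\<dots> \<le> (x / a + 1) * f a"
      using m that nonneg[of a] by (intro mult_right_mono) auto
    finally show ?thesis using that by (simp add: field_simps)
  qed
  have "((\<lambda>x. f x / x) \<longlongrightarrow> L) at_top"
  proof (rule order_tendstoI)
    fix b assume "b < L"
    show "\<forall>\<^sub>F x in at_top. b < f x / x"
      using eventually_gt_at_top[of 0] by eventually_elim (use \<open>b < L\<close> L_le in force)
  next
    fix b assume "L < b"
    then obtain a where a: "a > 0" "f a / a < b"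
      unfolding L_def using cINF_less_iff[OF _ bdd] by auto
    have "((\<lambda>x. f a / a + f a / x) \<longlongrightarrow> f a / a + 0) at_top"
      by (intro tendsto_add tendsto_const tendsto_divide_0[OF tendsto_const]
          filterlim_at_top_imp_at_infinity filterlim_ident)
    then have "\<forall>\<^sub>F x in at_top. f a / a + f a / x < b"
      by (rule order_tendstoD) (use a in simp)
    then show "\<forall>\<^sub>F x in at_top. f x / x < b"
      using eventually_gt_at_top[of 0] by eventually_elim (use upper a in force)
  qed
  then show ?thesis by (simp add: L_def)
qed

section \<open>Covering numbers on the real line\<close>

lemma tau_real_le:
  "finite T \<Longrightarrow> {0..x} \<subseteq> T + S \<Longrightarrow> tau_real S x \<le> card T"
  unfolding tau_real_def by (rule Least_le) auto

text \<open>\<open>LEAST\<close> carries information only once some finite cover exists. The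
  interval inside \<open>S\<close> provides one, by laying copies of it end to end.\<close>

lemma tau_real_attained:
  fixes a b :: real
  assumes "a < b" "{a..b} \<subseteq> S"
  obtains T where "finite T" "card T = tau_real S x" "{0..x} \<subseteq> T + S"
proof -
  define d where "d = b - a"
  \<comment> \<open>Translation by \<open>i * d - a\<close> moves \<open>{a..b}\<close> onto
    \<open>{i * d..(i + 1) * d}\<close>.\<close>
  define T where "T = (\<lambda>i::nat. real i * d - a) ` {..nat \<lfloor>x / d\<rfloor>}"
  have d: "d > 0" using assms by (simp add: d_def)
  have "{0..x} \<subseteq> T + S"
  proof
    fix y assume y: "y \<in> {0..x}"
    define i where "i = nat \<lfloor>y / d\<rfloor>"
    have i: "real i \<le> y / d" "y / d \<le> real i + 1"
      using y d by (auto simp: i_def)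
    have "i \<le> nat \<lfloor>x / d\<rfloor>"
      unfolding i_def using y d by (intro nat_mono floor_mono) (simp add: divide_right_mono)
    then have "real i * d - a \<in> T" by (auto simp: T_def)
    moreover have "y - (real i * d - a) \<in> S"
      using i d assms(2) by (intro subsetD[OF assms(2)]) (auto simp: field_simps d_def)
    ultimately have "(real i * d - a) + (y - (real i * d - a)) \<in> T + S"
      by (rule set_plus_intro)
    then show "y \<in> T + S" by simp
  qed
  moreover have "finite T" by (simp add: T_def)
  ultimately have "\<exists>n T. finite T \<and> card T = n \<and> {0..x} \<subseteq> T + S" by blast
  then have "\<exists>T. finite T \<and> card T = tau_real S x \<and> {0..x} \<subseteq> T + S"
    unfolding tau_real_def by (rule LeastI_ex)
  then show thesis using that by blast
qed

text \<open>A cover of \<open>{0..x}\<close> together with a cover of \<open>{0..y}\<close> shifted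
  by \<open>x\<close> covers \<open>{0..x + y}\<close>, so Fekete's lemma applies.
  \<open>Lim\<close> then denotes the limit found.\<close>

lemma tau_real_tendsto:
  fixes a b :: real
  assumes "a < b" "{a..b} \<subseteq> S"
  shows "((\<lambda>x. real (tau_real S x) / x) \<longlongrightarrow> tau_R S) at_top"
proof -
  have mono: "tau_real S x \<le> tau_real S y" if "x \<le> y" for x y
  proof -
    obtain T where "finite T" "card T = tau_real S y" "{0..y} \<subseteq> T + S"
      using tau_real_attained[OF assms] by blast
    then show ?thesis
      using that tau_real_le[of T x S] by fastforce
  qed
  have subadd: "tau_real S (x + y) \<le> tau_real S x + tau_real S y" for x y
  proof -
    obtain T where T: "finite T" "card T = tau_real S x" "{0..x} \<subseteq> T + S"
      using tau_real_attained[OF assms] by blast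
    obtain U where U: "finite U" "card U = tau_real S y" "{0..y} \<subseteq> U + S"
      using tau_real_attained[OF assms] by blast
    have "{0..x + y} \<subseteq> (T \<union> (+) x ` U) + S"
    proof
      fix z assume z: "z \<in> {0..x + y}"
      show "z \<in> (T \<union> (+) x ` U) + S"
      proof (cases "z \<le> x")
        case True
        then have "z \<in> T + S" using z T by auto
        then show ?thesis by (auto simp: set_plus_def)
      next
        case False
        then have "z - x \<in> U + S" using z U by auto
        then obtain u s where "u \<in> U" "s \<in> S" "z - x = u + s" by (auto elim: set_plus_elim)
        then have "z = (x + u) + s" "x + u \<in> T \<union> (+) x ` U" by auto
        with \<open>s \<in> S\<close> show ?thesis by (metis set_plus_intro)
      qed
    qed
    then have "tau_real S (x + y) \<le> card (T \<union> (+) x ` U)"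
      using T U by (intro tau_real_le) auto
    also have "\<dots> \<le> card T + card U"
      by (metis U(1) add_left_mono card_Un_le card_image_le le_trans)
    finally show ?thesis using T U by simp
  qed
  have "((\<lambda>x. real (tau_real S x) / x) \<longlongrightarrow> (INF a\<in>{0<..}. real (tau_real S a) / a)) at_top"
    by (rule mono_subadditive_tendsto) (use mono subadd in \<open>auto simp flip: of_nat_add\<close>)
  then show ?thesis
    unfolding tau_R_def by (metis tendsto_Lim trivial_limit_at_top_linorder)
qed

lemma e_R_nonneg:
  fixes a b :: real
  assumes "a < b" "{a..b} \<subseteq> S"
  shows "0 \<le> e_R S"
proof -
  have "0 \<le> tau_R S"
    by (rule tendsto_lowerbound[OF tau_real_tendsto[OF assms]])
      (auto intro: eventually_mono[OF eventually_gt_at_top[of 0]])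
  then show ?thesis by (simp add: e_R_def)
qed

text \<open>Positive measure excludes the empty set and singletons, so \<open>I\<close> has two
  distinct points and hence the segment between them.\<close>

lemma bounded_pos_interval_contains_Icc:
  assumes "bounded_pos_interval I"
  obtains a b where "a < b" "{a..b} \<subseteq> I"
proof -
  have I: "is_interval I" "measure lebesgue I > 0"
    using assms by (auto simp: bounded_pos_interval_def)
  obtain a where a: "a \<in> I" using I(2) by fastforce
  have "I \<noteq> {a}" using I(2) by auto
  then obtain b where b: "b \<in> I" "b \<noteq> a" using a by blast
  have "{min a b..max a b} \<subseteq> I"
    using mem_is_interval_1_I[OF I(1) a b(1)] mem_is_interval_1_I[OF I(1) b(1) a]
    by (cases "a \<le> b") auto
  then show thesis using b by (intro that[of "min a b" "max a b"]) auto
qed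

text \<open>This gives the lower bound 0 for the sets whose infima are \<open>beta k\<close> and
  \<open>gamma k\<close>.\<close>

lemma e_R_UN_nonneg:
  fixes I :: "nat \<Rightarrow> real set"
  assumes "k \<ge> 1" "\<forall>i\<in>{1..k}. bounded_pos_interval (I i)"
  shows "0 \<le> e_R (\<Union>i\<in>{1..k}. I i)"
proof -
  have "bounded_pos_interval (I 1)" using assms by simp
  then obtain a b where "a < b" "{a..b} \<subseteq> I 1"
    by (rule bounded_pos_interval_contains_Icc)
  then show ?thesis
    using assms(1) by (intro e_R_nonneg[of a b]) force+
qed

section \<open>Covering numbers on the integers\<close>

lemma tau_int_le:
  "finite T \<Longrightarrow> {1..int n} \<subseteq> T + S \<Longrightarrow> tau_int S n \<le> card T"
  unfolding tau_int_def by (rule Least_le) auto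

lemma tau_int_attained:
  assumes "S \<noteq> {}"
  obtains T where "finite T" "card T = tau_int S n" "{1..int n} \<subseteq> T + S"
proof -
  obtain s where s: "s \<in> S" using assms by auto
  define T where "T = (\<lambda>j. j - s) ` {1..int n}"
  have "{1..int n} \<subseteq> T + S"
  proof
    fix j assume "j \<in> {1..int n}"
    then have "(j - s) + s \<in> T + S" using s by (intro set_plus_intro) (auto simp: T_def)
    then show "j \<in> T + S" by simp
  qed
  moreover have "finite T" by (simp add: T_def)
  ultimately have "\<exists>m T. finite T \<and> card T = m \<and> {1..int n} \<subseteq> T + S" by blast
  then have "\<exists>T. finite T \<and> card T = tau_int S n \<and> {1..int n} \<subseteq> T + S"
    unfolding tau_int_def by (rule LeastI_ex)
  then show thesis using that by blast
qed

lemma tau_int_tendsto: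
  assumes "S \<noteq> {}"
  shows "(\<lambda>n. real (tau_int S n) / real n) \<longlonglongrightarrow> tau_Z S"
proof -
  have mono: "tau_int S m \<le> tau_int S n" if "m \<le> n" for m n
  proof -
    obtain T where "finite T" "card T = tau_int S n" "{1..int n} \<subseteq> T + S"
      using tau_int_attained[OF assms] by blast
    then show ?thesis
      using that tau_int_le[of T m S] by fastforce
  qed
  have subadd: "tau_int S (m + n) \<le> tau_int S m + tau_int S n" for m n
  proof -
    obtain T where T: "finite T" "card T = tau_int S m" "{1..int m} \<subseteq> T + S"
      using tau_int_attained[OF assms] by blast
    obtain U where U: "finite U" "card U = tau_int S n" "{1..int n} \<subseteq> U + S"
      using tau_int_attained[OF assms] by blast
    have "{1..int (m + n)} \<subseteq> (T \<union> (+) (int m) ` U) + S"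
    proof
      fix z assume z: "z \<in> {1..int (m + n)}"
      show "z \<in> (T \<union> (+) (int m) ` U) + S"
      proof (cases "z \<le> int m")
        case True
        then have "z \<in> T + S" using z T by auto
        then show ?thesis by (auto simp: set_plus_def)
      next
        case False
        then have "z - int m \<in> U + S" using z U by auto
        then obtain u s where "u \<in> U" "s \<in> S" "z - int m = u + s" by (auto elim: set_plus_elim)
        then have "z = (int m + u) + s" "int m + u \<in> T \<union> (+) (int m) ` U" by auto
        with \<open>s \<in> S\<close> show ?thesis by (metis set_plus_intro)
      qed
    qed
    then have "tau_int S (m + n) \<le> card (T \<union> (+) (int m) ` U)"
      using T U by (intro tau_int_le) auto
    also have "\<dots> \<le> card T + card U"
      by (metis U(1) add_left_mono card_Un_le card_image_le le_trans)
    finally show ?thesis using T U by simp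
  qed
  \<comment> \<open>Rounding up extends the covering number to real arguments, so the same Fekete
    lemma serves. Monotonicity and subadditivity survive because the ceiling is itself monotone and
    subadditive.\<close>
  define f where "f x = real (tau_int S (nat \<lceil>x\<rceil>))" for x :: real
  obtain L where "((\<lambda>x. f x / x) \<longlongrightarrow> L) at_top"
  proof (rule that, rule mono_subadditive_tendsto)
    fix x y :: real assume "0 \<le> x" "0 \<le> y"
    have "tau_int S (nat \<lceil>x + y\<rceil>) \<le> tau_int S (nat \<lceil>x\<rceil> + nat \<lceil>y\<rceil>)"
      by (rule mono) linarith
    also note subadd
    finally show "f (x + y) \<le> f x + f y" by (simp add: f_def)
  qed (auto simp: f_def intro!: mono nat_mono ceiling_mono)
  then have "(\<lambda>n. f (real n) / real n) \<longlonglongrightarrow> L"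
    by (rule filterlim_compose[OF _ filterlim_real_sequentially])
  then show ?thesis
    unfolding tau_Z_def by (simp add: f_def limI)
qed

text \<open>\<open>T + S\<close> has at most \<open>card T * card S\<close> elements. Besides the
  bound \<open>e_Z S \<le> 1\<close>, this keeps the denominator in \<open>e_Z\<close>
  positive.\<close>

lemma tau_Z_ge:
  assumes "finite S" "S \<noteq> {}"
  shows "1 \<le> tau_Z S * real (card S)"
proof -
  have "1 \<le> real (tau_int S n) / real n * real (card S)" if "n > 0" for n
  proof -
    obtain T where T: "finite T" "card T = tau_int S n" "{1..int n} \<subseteq> T + S"
      using tau_int_attained[OF assms(2)] by blast
    have sum: "T + S = (\<lambda>(t, s). t + s) ` (T \<times> S)" by (auto simp: set_plus_def)
    have "n = card {1..int n}" by simp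
    also have "\<dots> \<le> card ((\<lambda>(t, s). t + s) ` (T \<times> S))"
      using T assms unfolding sum by (intro card_mono) auto
    also have "\<dots> \<le> card (T \<times> S)" using T assms by (intro card_image_le) auto
    also have "\<dots> = tau_int S n * card S" using T by (simp add: card_cartesian_product)
    finally have "real n \<le> real (tau_int S n) * real (card S)"
      by (simp flip: of_nat_mult)
    then show ?thesis using that by (simp add: field_simps)
  qed
  then show ?thesis
    by (intro tendsto_lowerbound[OF tendsto_mult_right[OF tau_int_tendsto[OF assms(2)]]])
      (auto intro: eventually_mono[OF eventually_gt_at_top[of 0]])
qed

section \<open>From integer sets to unions of unit intervals\<close>

text \<open>This is \<open>S + [0,1)\<close>. Half-open cells at distinct integers are disjoint, so
  measure matches cardinality, and they make the rounding of translations exact.\<close>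

definition thickening :: "int set \<Rightarrow> real set" where
  "thickening S = (\<Union>s\<in>S. {real_of_int s..<real_of_int s + 1})"

lemma tau_int_le_tau_real_thickening:
  assumes "S \<noteq> {}"
  shows "tau_int S n \<le> tau_real (thickening S) (real n)"
proof -
  obtain s where s: "s \<in> S" using assms by auto
  \<comment> \<open>The length 1/2 keeps a closed interval inside the half-open cell at
    \<open>s\<close>.\<close>
  have "{real_of_int s..real_of_int s + 1/2} \<subseteq> thickening S"
    using s by (force simp: thickening_def)
  then obtain T where T: "finite T" "card T = tau_real (thickening S) (real n)"
      "{0..real n} \<subseteq> T + thickening S"
    by (rule tau_real_attained[rotated]) auto
  have "{1..int n} \<subseteq> ceiling ` T + S"
  proof
    fix j assume "j \<in> {1..int n}"
    then have "real_of_int j \<in> {0..real n}" by auto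
    then obtain t v where t: "t \<in> T" and v: "v \<in> thickening S" and j: "real_of_int j = t + v"
      using T(3) by (blast elim: set_plus_elim)
    then obtain r where r: "r \<in> S" "real_of_int r \<le> v" "v < real_of_int r + 1"
      by (auto simp: thickening_def)
    \<comment> \<open>From \<open>t = j - v\<close> and \<open>r \<le> v < r + 1\<close> follows
      \<open>j - r - 1 < t \<le> j - r\<close>.\<close>
    have "\<lceil>t\<rceil> = j - r" using r j by (intro ceiling_unique) auto
    then have "j = \<lceil>t\<rceil> + r" by simp
    then show "j \<in> ceiling ` T + S" using t r(1) by (blast intro: set_plus_intro)
  qed
  then have "tau_int S n \<le> card (ceiling ` T)" using T by (intro tau_int_le) auto
  then show ?thesis using T card_image_le le_trans by metis
qed

lemma measure_thickening:
  assumes "finite S"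
  shows "measure lebesgue (thickening S) = real (card S)"
proof -
  have "disjoint_family_on (\<lambda>s. {real_of_int s..<real_of_int s + 1}) S"
    by (auto simp: disjoint_family_on_def)
  then have "measure lebesgue (thickening S)
      = (\<Sum>s\<in>S. measure lebesgue {real_of_int s..<real_of_int s + 1})"
    unfolding thickening_def using assms by (intro measure_finite_Union) auto
  then show ?thesis by simp
qed

text \<open>Since the measure of the thickening is \<open>card S\<close>, only the covering
  densities differ. They compare by taking the limit of the previous inequality along the natural
  numbers.\<close>

lemma e_R_thickening_le:
  assumes "finite S" "S \<noteq> {}"
  shows "e_R (thickening S) \<le> e_Z S"
proof -
  obtain s where s: "s \<in> S" using assms by auto
  have sub: "{real_of_int s..real_of_int s + 1/2} \<subseteq> thickening S"
    using s by (force simp: thickening_def)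
  have "((\<lambda>x. real (tau_real (thickening S) x) / x) \<longlongrightarrow> tau_R (thickening S)) at_top"
    by (rule tau_real_tendsto[OF _ sub]) simp
  then have lim: "(\<lambda>n. real (tau_real (thickening S) (real n)) / real n)
      \<longlonglongrightarrow> tau_R (thickening S)"
    by (rule filterlim_compose[OF _ filterlim_real_sequentially])
  have "tau_Z S \<le> tau_R (thickening S)"
    using tau_int_le_tau_real_thickening[OF assms(2)]
    by (intro LIMSEQ_le[OF tau_int_tendsto[OF assms(2)] lim] exI allI impI divide_right_mono) auto
  then have "tau_Z S * real (card S) \<le> tau_R (thickening S) * real (card S)"
    by (rule mult_right_mono) simp
  then show ?thesis
    \<comment> \<open>The lower bound 1 makes both denominators positive, so taking reciprocals
      reverses the inequality.\<close>
    using tau_Z_ge[OF assms] unfolding e_R_def e_Z_def measure_thickening[OF assms(1)]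
    by (intro divide_left_mono) auto
qed

theorem theorem8p1:
  fixes k :: nat
  assumes "k \<ge> 1"
  shows "beta k \<le> gamma k \<and> gamma k \<le> alpha k \<and> alpha k \<le> 1"
proof -
  let ?A = "{e_Z S | S. finite S \<and> card S = k}"
  let ?B = "{e_R (\<Union>i\<in>{1..k}. I i) | I. \<forall>i\<in>{1..k}. bounded_pos_interval (I i)}"
  let ?C = "{e_R (\<Union>i\<in>{1..k}. I i) | I.
     (\<forall>i\<in>{1..k}. bounded_pos_interval (I i)) \<and>
     (\<forall>i\<in>{1..k}. \<forall>j\<in>{1..k}. measure lebesgue (I i) = measure lebesgue (I j))}"
  have bddB: "bdd_below ?B"
    by (rule bdd_belowI[of _ 0]) (use e_R_UN_nonneg[OF assms] in blast)
  have CB: "?C \<subseteq> ?B" by blast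
  have bddC: "bdd_below ?C" by (rule bdd_below_mono[OF bddB CB])
  \<comment> \<open>A bijection from \<open>{1..k}\<close> to \<open>S\<close> indexes the cells,
    which all have length 1.\<close>
  have thick: "e_R (thickening S) \<in> ?C" if S: "finite S" "card S = k" for S
  proof -
    obtain h where h: "bij_betw h {1..k} S"
      using ex_bij_betw_nat_finite_1[OF S(1)] S(2) by auto
    define I where "I i = {real_of_int (h i)..<real_of_int (h i) + 1}" for i
    have "thickening S = (\<Union>i\<in>{1..k}. I i)"
      using bij_betw_imp_surj_on[OF h] by (auto simp: thickening_def I_def)
    moreover have "bounded_pos_interval (I i)" for i
      by (auto simp: bounded_pos_interval_def I_def is_interval_co)
    moreover have "measure lebesgue (I i) = 1" for i by (simp add: I_def)
    ultimately show ?thesis by (intro CollectI exI[of _ I]) simp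
  qed
  have ne: "S \<noteq> {}" if "card S = k" for S :: "int set"
    using that assms by auto
  \<comment> \<open>A sample set of size \<open>k\<close>: it shows that \<open>?A\<close> and,
    through its thickening, \<open>?C\<close> are nonempty, as the \<open>Inf\<close> rules
    demand.\<close>
  have card_k: "finite {1..int k}" "card {1..int k} = k" by simp_all
  then have A_ne: "e_Z {1..int k} \<in> ?A" by blast
  have "0 \<le> e_Z S \<and> e_Z S \<le> 1" if "finite S" "card S = k" for S
    using tau_Z_ge[OF that(1) ne[OF that(2)]] by (auto simp: e_Z_def)
  then have A01: "\<forall>e\<in>?A. 0 \<le> e \<and> e \<le> 1" by blast
  have "beta k \<le> gamma k"
    unfolding beta_def gamma_def
    by (rule cInf_superset_mono[OF _ bddB CB]) (use thick[OF card_k] in blast)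
  moreover have "gamma k \<le> alpha k"
    unfolding alpha_def
  proof (rule cInf_greatest)
    fix e assume "e \<in> ?A"
    then obtain S where S: "finite S" "card S = k" "e = e_Z S" by blast
    have "gamma k \<le> e_R (thickening S)"
      unfolding gamma_def by (rule cInf_lower[OF thick[OF S(1,2)] bddC])
    also have "\<dots> \<le> e" using e_R_thickening_le S ne by simp
    finally show "gamma k \<le> e" .
  qed (use A_ne in blast)
  moreover have "alpha k \<le> 1"
  proof -
    have "alpha k \<le> e_Z {1..int k}"
      unfolding alpha_def by (rule cInf_lower[OF A_ne bdd_belowI[of _ 0]]) (use A01 in blast)
    also have "\<dots> \<le> 1" using A01 A_ne by blast
    finally show ?thesis .
  qed
  ultimately show ?thesis by blast
qed

end
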